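(* Let $k$ balls be dropped into $n$ urns labeled $1,\dots,n$, where the locations of the balls are independent and identically distributed, chosen from some probability distribution on $\{1,\dots,n\}$. Let $X_i\in\{0,1\}$ be the indicator of the event that urn $i$ is non-empty, $1\le i\le n$. Then the random variables $X_1,\dots,X_n$ are negatively associated.
   Context: $\{0,1\}$-valued random variables $X_1,\dots,X_n$ are negatively associated if for every $A\subseteq\{1,\dots,n\}$ and every pair of coordinatewise increasing (non-decreasing) functions $f:\{0,1\}^A\to\mathbb{R}$ and $g:\{0,1\}^{A^c}\to\mathbb{R}$, $\mathbf{E}[f((X_i)_{i\in A})\,g((X_i)_{i\notin A})]\le \mathbf{E}[f((X_i)_{i\in A})]\,\mathbf{E}[g((X_i)_{i\notin A})]$. *)

theory Defs
  imports "HOL-Probability.Probability"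
begin

text \<open>
  A vector in $\{0,1\}^A$ is a function in \<open>A \<rightarrow>\<^sub>E {0, 1}\<close>. Such functions agree
  (with \<open>undefined\<close>) outside \<open>A\<close>, so the pointwise order of the function type used by
  \<open>mono_on\<close> is the coordinatewise order of the cube. All expectations below are of bounded
  random variables taking finitely many values, so no integrability proviso is needed.
\<close>

definition (in prob_space) neg_assoc :: "('i \<Rightarrow> 'a \<Rightarrow> real) \<Rightarrow> 'i set \<Rightarrow> bool" where
  "neg_assoc X I \<longleftrightarrow>
     finite I \<and>
     (\<forall>i\<in>I. random_variable borel (X i) \<and> X i \<in> space M \<rightarrow> {0, 1}) \<and>
     (\<forall>A (f :: ('i \<Rightarrow> real) \<Rightarrow> real) (g :: ('i \<Rightarrow> real) \<Rightarrow> real).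
        A \<subseteq> I \<longrightarrow>
        mono_on (A \<rightarrow>\<^sub>E {0, 1}) f \<longrightarrow>
        mono_on ((I - A) \<rightarrow>\<^sub>E {0, 1}) g \<longrightarrow>
        expectation (\<lambda>\<omega>. f (\<lambda>i\<in>A. X i \<omega>) * g (\<lambda>i\<in>I - A. X i \<omega>))
          \<le> expectation (\<lambda>\<omega>. f (\<lambda>i\<in>A. X i \<omega>)) * expectation (\<lambda>\<omega>. g (\<lambda>i\<in>I - A. X i \<omega>)))"

text \<open>\<open>B j \<omega>\<close> is the urn that receives ball \<open>j\<close>.\<close>

definition urn_nonempty :: "nat \<Rightarrow> (nat \<Rightarrow> 'a \<Rightarrow> nat) \<Rightarrow> nat \<Rightarrow> 'a \<Rightarrow> real" where
  "urn_nonempty k B i = indicator {\<omega>. \<exists>j\<in>{1..k}. B j \<omega> = i}"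

end

(* Drop the balls one at a time. Given the set T of urns occupied so far, let the next ball land
   in y. For increasing F and G depending on disjoint sets of urns, the increments of F and of G
   caused by y are nonnegative and never both nonzero, so F and G are conditionally negatively
   correlated. Averaging F and G over y gives increasing functions of T that depend on the same
   urns as before, so the claim follows by induction on the number of balls. *)

theory Submission
  imports Defs
begin

text \<open>A finite product of discrete sigma-algebras on a countable type is again discrete. Hence
  monotone functions on the cube can be integrated without a measurability hypothesis.\<close>

lemma measurable_PiM_discrete:
  fixes h :: "('i \<Rightarrow> 'a::countable) \<Rightarrow> 'b"
  assumes "finite J" "\<And>j. j \<in> J \<Longrightarrow> sets (N j) = UNIV" "\<And>x. h x \<in> space L"
  shows "h \<in> PiM J N \<rightarrow>\<^sub>M L"
proof -
  have "sets (PiM J N) = sets (PiM J (\<lambda>_. count_space UNIV))"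
    using assms(2) by (intro sets_PiM_cong) auto
  also have "\<dots> = sets (count_space (J \<rightarrow>\<^sub>E UNIV))"
    using assms(1) by (subst count_space_PiM_finite) auto
  finally have "h \<in> PiM J N \<rightarrow>\<^sub>M L \<longleftrightarrow> h \<in> count_space (J \<rightarrow>\<^sub>E UNIV) \<rightarrow>\<^sub>M L"
    using measurable_cong_sets[OF _ refl] by blast
  then show ?thesis
    using assms(3) by simp
qed

text \<open>The trace \<open>S \<omega> \<inter> I\<close> ranges over the finite set
  \<open>Pow I\<close>, so the composition with \<open>H\<close> is bounded. This is why every
  integrand below is written as a function of a trace on a finite set.\<close>

lemma (in prob_space) integrable_finite_trace:
  fixes H :: "'b set \<Rightarrow> real"
  assumes "finite I" "(\<lambda>\<omega>. H (S \<omega> \<inter> I)) \<in> borel_measurable M"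
  shows "integrable M (\<lambda>\<omega>. H (S \<omega> \<inter> I))"
proof (rule integrable_const_bound)
  show "AE \<omega> in M. norm (H (S \<omega> \<inter> I)) \<le> Max ((\<lambda>T. \<bar>H T\<bar>) ` Pow I)"
    using assms(1) by (auto intro!: Max_ge)
qed (fact assms(2))

lemma integrable_pmf_trace:
  fixes p :: "'u::countable pmf" and H :: "'u set \<Rightarrow> real"
  assumes "finite I"
  shows "integrable (measure_pmf p) (\<lambda>y. H (insert y T \<inter> I))"
  using assms by (intro measure_pmf.integrable_finite_trace) auto

lemma integrable_PiM_trace:
  fixes p :: "'u::countable pmf" and H :: "'u set \<Rightarrow> real" and J :: "'j set"
  assumes "finite J" "finite I"
  shows "integrable (PiM J (\<lambda>_. measure_pmf p)) (\<lambda>x. H (x ` J \<inter> I))"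
proof -
  interpret prob_space "PiM J (\<lambda>_. measure_pmf p)"
    by (intro prob_space_PiM measure_pmf.prob_space_axioms)
  show ?thesis
    using assms by (intro integrable_finite_trace measurable_PiM_discrete) auto
qed

text \<open>Fubini, with ball \<open>j\<close> integrated innermost. By \<open>upd\<close>, the
  other balls matter only through their trace on \<open>I\<close>, so the inner integral is once
  more a function of that trace and the lemma can be iterated.\<close>

lemma integral_PiM_insert_trace:
  fixes p :: "'u::countable pmf" and H :: "'u set \<Rightarrow> real" and J :: "'j set"
  assumes "finite J" "j \<notin> J" "finite I"
  shows "(\<integral>x. H (x ` insert j J \<inter> I) \<partial>PiM (insert j J) (\<lambda>_. measure_pmf p)) =
         (\<integral>x. (\<integral>y. H (insert y (x ` J \<inter> I) \<inter> I) \<partial>measure_pmf p) \<partial>PiM J (\<lambda>_. measure_pmf p))"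
proof -
  interpret product_sigma_finite "\<lambda>_::'j. measure_pmf p"
    by standard
  have upd: "(x(j := y)) ` insert j J \<inter> I = insert y (x ` J \<inter> I) \<inter> I" for x :: "'j \<Rightarrow> 'u" and y
    using assms(2) by auto
  show ?thesis
    using assms by (subst product_integral_insert) (simp_all only: upd integrable_PiM_trace finite_insert not_False_eq_True)
qed

lemma one_ball_neg_correlated:
  fixes p :: "'u::countable pmf" and F G :: "'u set \<Rightarrow> real"
  assumes "finite A" "finite C" "A \<inter> C = {}" "mono_on (Pow A) F" "mono_on (Pow C) G"
  shows "(\<integral>y. F (insert y T \<inter> A) * G (insert y T \<inter> C) \<partial>measure_pmf p) \<le>
         (\<integral>y. F (insert y T \<inter> A) \<partial>measure_pmf p) * (\<integral>y. G (insert y T \<inter> C) \<partial>measure_pmf p)"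
proof -
  define \<phi> where "\<phi> y = F (insert y T \<inter> A)" for y
  define \<psi> where "\<psi> y = G (insert y T \<inter> C)" for y
  define a where "a = F (T \<inter> A)"
  define b where "b = G (T \<inter> C)"
  have int [simp]: "integrable p \<phi>" "integrable p \<psi>"
    unfolding \<phi>_def \<psi>_def using assms by (auto intro: integrable_pmf_trace)
  have "a \<le> \<phi> y" "b \<le> \<psi> y" for y
    unfolding a_def b_def \<phi>_def \<psi>_def
    by (rule mono_onD[OF assms(4)] mono_onD[OF assms(5)]; blast)+
  then have ge: "a \<le> (\<integral>y. \<phi> y \<partial>p)" "b \<le> (\<integral>y. \<psi> y \<partial>p)"
    by (auto intro!: measure_pmf.integral_ge_const)
  \<comment> \<open>This is \<open>(\<phi> y - a) * (\<psi> y - b) = 0\<close> expanded, where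
    \<open>a\<close> and \<open>b\<close> are the values before the ball falls. The expanded form is
    linear in \<phi> and \<psi>, so it integrates term by term.\<close>
  have "\<phi> y * \<psi> y = b * \<phi> y + a * \<psi> y - a * b" for y
  proof -
    have "insert y T \<inter> A = T \<inter> A \<or> insert y T \<inter> C = T \<inter> C"
      using assms(3) by blast
    then have "\<phi> y = a \<or> \<psi> y = b"
      unfolding \<phi>_def \<psi>_def a_def b_def by (rule disj_forward) (simp_all only:)
    then show ?thesis
      by (elim disjE) (simp_all only: mult.commute add.commute diff_add_cancel add_diff_cancel_left' add_diff_cancel_right')
  qed
  then have "(\<integral>y. \<phi> y * \<psi> y \<partial>p) = b * (\<integral>y. \<phi> y \<partial>p) + a * (\<integral>y. \<psi> y \<partial>p) - a * b"
    by simp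
  \<comment> \<open>By the previous identity, this product is exactly the right side of the claim
    minus the left side.\<close>
  moreover have "0 \<le> ((\<integral>y. \<phi> y \<partial>p) - a) * ((\<integral>y. \<psi> y \<partial>p) - b)"
    using ge by simp
  ultimately show ?thesis
    by (simp add: \<phi>_def \<psi>_def algebra_simps)
qed

lemma mono_on_average_ball:
  fixes p :: "'u::countable pmf" and F :: "'u set \<Rightarrow> real"
  assumes "finite A" "mono_on (Pow A) F"
  shows "mono_on (Pow A) (\<lambda>T. \<integral>y. F (insert y T \<inter> A) \<partial>measure_pmf p)"
proof (rule mono_onI, rule integral_mono)
  fix T T' y
  assume "T \<in> Pow A" "T' \<in> Pow A" "T \<subseteq> T'"
  then show "F (insert y T \<inter> A) \<le> F (insert y T' \<inter> A)"
    by (intro mono_onD[OF assms(2)]) blast+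
qed (auto intro: integrable_pmf_trace assms(1))

lemma balls_neg_correlated:
  fixes p :: "'u::countable pmf" and F G :: "'u set \<Rightarrow> real" and J :: "'j set"
  assumes "finite J" "finite A" "finite C" "A \<inter> C = {}" "mono_on (Pow A) F" "mono_on (Pow C) G"
  defines "P \<equiv> \<lambda>J. PiM J (\<lambda>_::'j. measure_pmf p)"
  shows "(\<integral>x. F (x ` J \<inter> A) * G (x ` J \<inter> C) \<partial>P J) \<le>
         (\<integral>x. F (x ` J \<inter> A) \<partial>P J) * (\<integral>x. G (x ` J \<inter> C) \<partial>P J)"
  using assms(1,5,6)
\<comment> \<open>\<open>F\<close> and \<open>G\<close> are generalized because the induction
  hypothesis is applied to their one-ball averages \<open>F'\<close> and \<open>G'\<close>.\<close>
proof (induction J arbitrary: F G rule: finite_induct)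
  case empty
  interpret prob_space "P {}"
    unfolding P_def by (intro prob_space_PiM measure_pmf.prob_space_axioms)
  show ?case
    by (simp add: prob_space)
next
  case (insert j J)
  note [simp] = assms(2,3) insert.hyps
  define F' where "F' T = (\<integral>y. F (insert y T \<inter> A) \<partial>measure_pmf p)" for T
  define G' where "G' T = (\<integral>y. G (insert y T \<inter> C) \<partial>measure_pmf p)" for T
  \<comment> \<open>\<open>K\<close> turns the product, which involves two traces, into a function
    of the single trace on \<open>A \<union> C\<close>, the form that the integration lemmas
    require.\<close>
  define K where "K T = F (T \<inter> A) * G (T \<inter> C)" for T
  define K' where "K' T = (\<integral>y. K (insert y T \<inter> (A \<union> C)) \<partial>measure_pmf p)" for T
  have AC: "T \<inter> (A \<union> C) \<inter> A = T \<inter> A" "T \<inter> (A \<union> C) \<inter> C = T \<inter> C" for T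
    by auto
  have K: "F (T \<inter> A) * G (T \<inter> C) = K (T \<inter> (A \<union> C))" for T
    unfolding K_def AC ..
  \<comment> \<open>The one-ball inequality, conditional on the trace
    \<open>T \<inter> (A \<union> C)\<close> left by the earlier balls. On the right each factor
    sees only its own part of that trace.\<close>
  have step: "K' (T \<inter> (A \<union> C)) \<le> F' (T \<inter> A) * G' (T \<inter> C)" for T
  proof -
    have ins: "insert y (T \<inter> (A \<union> C)) \<inter> A = insert y (T \<inter> A) \<inter> A"
      "insert y (T \<inter> (A \<union> C)) \<inter> C = insert y (T \<inter> C) \<inter> C" for y
      by auto
    show ?thesis
      using one_ball_neg_correlated[OF assms(2-4) insert.prems, where p = p and T = "T \<inter> (A \<union> C)"]
      unfolding K'_def K_def F'_def G'_def AC ins .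
  qed
  have K'': "F' (T \<inter> A) * G' (T \<inter> C) = (\<lambda>T. F' (T \<inter> A) * G' (T \<inter> C)) (T \<inter> (A \<union> C))" for T
    unfolding AC ..
  have "(\<integral>x. F (x ` insert j J \<inter> A) * G (x ` insert j J \<inter> C) \<partial>P (insert j J)) =
        (\<integral>x. K' (x ` J \<inter> (A \<union> C)) \<partial>P J)"
    unfolding K K'_def P_def by (intro integral_PiM_insert_trace) auto
  \<comment> \<open>Ball \<open>j\<close> has been integrated out. Now \<open>step\<close> is
    applied pointwise, then the induction hypothesis to \<open>F'\<close> and \<open>G'\<close>, and
    finally ball \<open>j\<close> is restored in each factor separately.\<close>
  also have "\<dots> \<le> (\<integral>x. F' (x ` J \<inter> A) * G' (x ` J \<inter> C) \<partial>P J)"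
  proof (intro integral_mono step)
    show "integrable (P J) (\<lambda>x. K' (x ` J \<inter> (A \<union> C)))"
      unfolding P_def by (rule integrable_PiM_trace) auto
    show "integrable (P J) (\<lambda>x. F' (x ` J \<inter> A) * G' (x ` J \<inter> C))"
      unfolding P_def by (subst K'', rule integrable_PiM_trace) auto
  qed
  also have "\<dots> \<le> (\<integral>x. F' (x ` J \<inter> A) \<partial>P J) * (\<integral>x. G' (x ` J \<inter> C) \<partial>P J)"
    using insert.prems unfolding F'_def G'_def by (intro insert.IH mono_on_average_ball) auto
  also have "(\<integral>x. F' (x ` J \<inter> A) \<partial>P J) = (\<integral>x. F (x ` insert j J \<inter> A) \<partial>P (insert j J))"
    unfolding F'_def P_def by (rule integral_PiM_insert_trace[symmetric]) auto
  also have "(\<integral>x. G' (x ` J \<inter> C) \<partial>P J) = (\<integral>x. G (x ` insert j J \<inter> C) \<partial>P (insert j J))"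
    unfolding G'_def P_def by (rule integral_PiM_insert_trace[symmetric]) auto
  finally show ?case .
qed

text \<open>Independence with common law \<open>p\<close> means that the joint law of the balls is
  the product measure, so the expectation can be computed on the canonical space.\<close>

lemma (in prob_space) expectation_image_iid:
  fixes p :: "'u::countable pmf" and h :: "'u set \<Rightarrow> real"
  assumes "finite J" "indep_vars (\<lambda>_. count_space UNIV) B J"
    and "\<And>j. j \<in> J \<Longrightarrow> distr M (count_space UNIV) (B j) = measure_pmf p"
  shows "expectation (\<lambda>\<omega>. h ((\<lambda>j. B j \<omega>) ` J)) = (\<integral>x. h (x ` J) \<partial>PiM J (\<lambda>_. measure_pmf p))"
\<comment> \<open>The description of independence by the joint law is applied to a nonempty index
  set; with no balls both sides are \<open>h {}\<close>.\<close>
proof (cases "J = {}")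
  case True
  interpret P: prob_space "PiM J (\<lambda>_. measure_pmf p)"
    by (intro prob_space_PiM measure_pmf.prob_space_axioms)
  show ?thesis
    using True P.prob_space by (simp add: prob_space)
next
  case False
  have rv: "random_variable (count_space UNIV) (B j)" if "j \<in> J" for j
    using assms(2) that by (auto simp: indep_vars_def)
  have "distr M (PiM J (\<lambda>_. count_space UNIV)) (\<lambda>\<omega>. \<lambda>j\<in>J. B j \<omega>) =
        PiM J (\<lambda>j. distr M (count_space UNIV) (B j))"
    using assms(2) False rv by (subst (asm) indep_vars_iff_distr_eq_PiM') auto
  also have "\<dots> = PiM J (\<lambda>_. measure_pmf p)"
    using assms(3) by (intro PiM_cong) auto
  finally have "(\<integral>x. h (x ` J) \<partial>PiM J (\<lambda>_. measure_pmf p)) =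
      (\<integral>x. h (x ` J) \<partial>distr M (PiM J (\<lambda>_. count_space UNIV)) (\<lambda>\<omega>. \<lambda>j\<in>J. B j \<omega>))"
    by simp
  also have "\<dots> = expectation (\<lambda>\<omega>. h ((\<lambda>j\<in>J. B j \<omega>) ` J))"
    using assms(1) rv by (intro integral_distr measurable_restrict measurable_PiM_discrete) auto
  finally show ?thesis
    by simp
qed

text \<open>Indicator vectors carry inclusion of subsets of \<open>A\<close> to the coordinatewise
  order on the cube, so the theorem can be reduced to increasing set functions.\<close>

lemma mono_on_cube_indicator:
  fixes f :: "('i \<Rightarrow> real) \<Rightarrow> real"
  assumes "mono_on (A \<rightarrow>\<^sub>E {0, 1}) f"
  shows "mono_on (Pow A) (\<lambda>T. f (\<lambda>i\<in>A. indicator T i))"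
proof (rule mono_onI, rule mono_onD[OF assms])
  fix T T' :: "'i set"
  assume "T \<subseteq> T'"
  then show "(\<lambda>i\<in>A. indicator T i :: real) \<le> (\<lambda>i\<in>A. indicator T' i)"
    by (auto simp: le_fun_def indicator_def)
qed (auto simp: indicator_def)

theorem mainTheorem2:
  fixes M :: "'a measure" and n k :: nat and p :: "nat pmf" and B :: "nat \<Rightarrow> 'a \<Rightarrow> nat"
  assumes "prob_space M"
    and "set_pmf p \<subseteq> {1..n}"
    and "prob_space.indep_vars M (\<lambda>_. count_space UNIV) B {1..k}"
    and "\<And>j. j \<in> {1..k} \<Longrightarrow> distr M (count_space UNIV) (B j) = measure_pmf p"
  shows "prob_space.neg_assoc M (urn_nonempty k B) {1..n}"
proof -
  interpret prob_space M by fact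
  have rv [measurable]: "B j \<in> M \<rightarrow>\<^sub>M count_space UNIV" if "j \<in> {1..k}" for j
    using assms(3) that by (auto simp: indep_vars_def)
  define S where "S \<omega> = (\<lambda>j. B j \<omega>) ` {1..k}" for \<omega>
  \<comment> \<open>\<open>S \<omega>\<close> is the set of occupied urns. Intersecting it with
    \<open>A\<close> leaves the vector unchanged and puts \<open>f\<close> and \<open>g\<close> into
    trace form.\<close>
  have X: "(\<lambda>i\<in>A. urn_nonempty k B i \<omega>) = (\<lambda>i\<in>A. indicator (S \<omega> \<inter> A) i)" for A \<omega>
    by (auto simp: urn_nonempty_def S_def indicator_def fun_eq_iff)
  have "urn_nonempty k B i \<in> borel_measurable M" for i
  proof -
    have "{\<omega> \<in> space M. \<exists>j\<in>{1..k}. B j \<omega> = i} \<in> sets M"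
      by measurable
    then show ?thesis
      unfolding urn_nonempty_def by (subst borel_measurable_indicator_iff) (simp add: Int_def conj_commute)
  qed
  moreover have "urn_nonempty k B i \<in> space M \<rightarrow> {0, 1}" for i
    by (auto simp: urn_nonempty_def indicator_def)
  moreover have "expectation (\<lambda>\<omega>. f (\<lambda>i\<in>A. urn_nonempty k B i \<omega>) * g (\<lambda>i\<in>{1..n} - A. urn_nonempty k B i \<omega>))
      \<le> expectation (\<lambda>\<omega>. f (\<lambda>i\<in>A. urn_nonempty k B i \<omega>)) *
        expectation (\<lambda>\<omega>. g (\<lambda>i\<in>{1..n} - A. urn_nonempty k B i \<omega>))"
    if A: "A \<subseteq> {1..n}" and f: "mono_on (A \<rightarrow>\<^sub>E {0, 1}) f" and g: "mono_on (({1..n} - A) \<rightarrow>\<^sub>E {0, 1}) g"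
    for A and f g :: "(nat \<Rightarrow> real) \<Rightarrow> real"
  proof -
    \<comment> \<open>Since \<open>h\<close> is arbitrary, this moves the product and both single
      factors to the product space, where \<open>balls_neg_correlated\<close> applies to
      \<open>A\<close> and its complement.\<close>
    have E: "expectation (\<lambda>\<omega>. h (S \<omega>)) = (\<integral>x. h (x ` {1..k}) \<partial>PiM {1..k} (\<lambda>_. measure_pmf p))"
      for h :: "nat set \<Rightarrow> real"
      unfolding S_def using assms by (intro expectation_image_iid) auto
    define F where "F T = f (\<lambda>i\<in>A. indicator T i)" for T
    define G where "G T = g (\<lambda>i\<in>{1..n} - A. indicator T i)" for T
    have "expectation (\<lambda>\<omega>. F (S \<omega> \<inter> A) * G (S \<omega> \<inter> ({1..n} - A)))
        \<le> expectation (\<lambda>\<omega>. F (S \<omega> \<inter> A)) * expectation (\<lambda>\<omega>. G (S \<omega> \<inter> ({1..n} - A)))"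
      unfolding E[of "\<lambda>T. F (T \<inter> A) * G (T \<inter> ({1..n} - A))"]
        E[of "\<lambda>T. F (T \<inter> A)"] E[of "\<lambda>T. G (T \<inter> ({1..n} - A))"]
      unfolding F_def G_def using A f g
      by (intro balls_neg_correlated mono_on_cube_indicator) (auto intro: finite_subset)
    then show ?thesis
      unfolding X F_def G_def .
  qed
  ultimately show ?thesis
    unfolding neg_assoc_def by blast
qed

end
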